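(* Let $R$ be a commutative ring with nonzero identity. The following statements are equivalent. (1) $GD(R)$ is a $T_0$-space. (2) For all $a,b\in R^\#$, $\sqrt{aR}=\sqrt{bR}$ implies $aR=bR$. (3) One of the following conditions holds: (a) $R$ is a von Neumann regular ring; (b) $R$ is a local ring with nonzero maximal ideal $\mathfrak m=\operatorname{Nil}(R)=aR$ for some $a\in R$, and $\mathfrak m^2=0$. (4) $GD(R)=D(R)$, i.e. the two topologies on $EC(R^\#)$ coincide.
   Context: For a commutative ring $R$ with nonzero identity and unit group $U(R)$, let $R^\#=R\setminus(U(R)\cup\{0\})$ be the set of nonzero nonunits. For $a,b\in R^\#$ write $a\sim b$ if $aR=bR$; $[a]$ denotes the equivalence class of $a$ and $EC(R^\#)$ the set of equivalence classes. For $a\in R^\#$ put $B_a=\{[b]\in EC(R^\#): b\mid a^n\text{ for some }n\geq 1\}$ and $U_a=\{[b]\in EC(R^\#): b\mid a\}$. The sets $B_a$ ($a\in R^\#$) form a basis of a topology on $EC(R^\#)$, denoted $GD(R)$ (the generalized divisor topology), and the sets $U_a$ ($a\in R^\#$) form a basis of a topology on $EC(R^\#)$, denoted $D(R)$ (the divisor topology). A commutative ring $R$ is von Neumann regular if for every $a\in R$ there is $x\in R$ with $a=a^2x$. $\operatorname{Nil}(R)$ is the nilradical of $R$. "Local" means having a unique maximal ideal (no Noetherian hypothesis). *)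

theory Defs
  imports "HOL-Algebra.Algebra" "HOL-Analysis.Abstract_Topological_Spaces"
begin

definition nonzero_nonunits :: "('a, 'b) ring_scheme \<Rightarrow> 'a set" where
  "nonzero_nonunits R = carrier R - (Units R \<union> {\<zero>\<^bsub>R\<^esub>})"

definition same_ideal_rel :: "('a, 'b) ring_scheme \<Rightarrow> ('a \<times> 'a) set" where
  "same_ideal_rel R =
     {(a, b). a \<in> nonzero_nonunits R \<and> b \<in> nonzero_nonunits R \<and> PIdl\<^bsub>R\<^esub> a = PIdl\<^bsub>R\<^esub> b}"

definition ideal_class :: "('a, 'b) ring_scheme \<Rightarrow> 'a \<Rightarrow> 'a set" where
  "ideal_class R a = same_ideal_rel R `` {a}"

definition EC :: "('a, 'b) ring_scheme \<Rightarrow> 'a set set" where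
  "EC R = nonzero_nonunits R // same_ideal_rel R"

definition GD_basic :: "('a, 'b) ring_scheme \<Rightarrow> 'a \<Rightarrow> 'a set set" where
  "GD_basic R a =
     {ideal_class R b | b. b \<in> nonzero_nonunits R \<and> (\<exists>n\<ge>1::nat. b divides\<^bsub>R\<^esub> (a [^]\<^bsub>R\<^esub> n))}"

definition D_basic :: "('a, 'b) ring_scheme \<Rightarrow> 'a \<Rightarrow> 'a set set" where
  "D_basic R a = {ideal_class R b | b. b \<in> nonzero_nonunits R \<and> b divides\<^bsub>R\<^esub> a}"

text \<open>
  The open sets are the arbitrary unions of basic sets. That these families are closed under
  finite intersections, so that \<^const>\<open>topology\<close> is applied to genuine topologies, and that the
  underlying set is \<^const>\<open>EC\<close>, is proved below.
\<close>

definition gen_divisor_topology :: "('a, 'b) ring_scheme \<Rightarrow> 'a set topology" where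
  "gen_divisor_topology R = topology (arbitrary union_of (\<lambda>V. V \<in> GD_basic R ` nonzero_nonunits R))"

definition divisor_topology :: "('a, 'b) ring_scheme \<Rightarrow> 'a set topology" where
  "divisor_topology R = topology (arbitrary union_of (\<lambda>V. V \<in> D_basic R ` nonzero_nonunits R))"

definition radical :: "('a, 'b) ring_scheme \<Rightarrow> 'a set \<Rightarrow> 'a set" where
  "radical R I = {r \<in> carrier R. \<exists>n\<ge>1::nat. r [^]\<^bsub>R\<^esub> n \<in> I}"

definition nilradical :: "('a, 'b) ring_scheme \<Rightarrow> 'a set" where
  "nilradical R = {r \<in> carrier R. \<exists>n\<ge>1::nat. r [^]\<^bsub>R\<^esub> n = \<zero>\<^bsub>R\<^esub>}"

definition von_neumann_regular :: "('a, 'b) ring_scheme \<Rightarrow> bool" where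
  "von_neumann_regular R \<longleftrightarrow>
     (\<forall>a\<in>carrier R. \<exists>x\<in>carrier R. a = a [^]\<^bsub>R\<^esub> (2::nat) \<otimes>\<^bsub>R\<^esub> x)"

definition local_ring :: "('a, 'b) ring_scheme \<Rightarrow> bool" where
  "local_ring R \<longleftrightarrow> (\<exists>!M. maximalideal M R)"


context cring
begin

lemma nonzero_nonunits_carrier: "a \<in> nonzero_nonunits R \<Longrightarrow> a \<in> carrier R"
  by (simp add: nonzero_nonunits_def)

lemma divides_iff_mem_PIdl: "b divides a \<longleftrightarrow> a \<in> PIdl b" if "b \<in> carrier R"
  using that by (auto simp: factor_def cgenideal_def m_comm)

lemma equiv_same_ideal_rel: "equiv (nonzero_nonunits R) (same_ideal_rel R)"
  by (rule equivI) (auto simp: same_ideal_rel_def refl_on_def sym_def trans_def)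

lemma ideal_class_eq_iff:
  assumes "a \<in> nonzero_nonunits R" "b \<in> nonzero_nonunits R"
  shows "ideal_class R a = ideal_class R b \<longleftrightarrow> PIdl a = PIdl b"
  using assms eq_equiv_class_iff[OF equiv_same_ideal_rel assms]
  by (auto simp: ideal_class_def same_ideal_rel_def)

lemma EC_eq: "EC R = ideal_class R ` nonzero_nonunits R"
  by (auto simp: EC_def quotient_def ideal_class_def)

lemma ideal_class_mem_D_basic:
  assumes b: "b \<in> nonzero_nonunits R"
  shows "ideal_class R b \<in> D_basic R a \<longleftrightarrow> b divides a"
proof
  assume "ideal_class R b \<in> D_basic R a"
  then obtain c where "c \<in> nonzero_nonunits R" "ideal_class R b = ideal_class R c" "c divides a"
    by (auto simp: D_basic_def)
  then show "b divides a"
    using b ideal_class_eq_iff divides_iff_mem_PIdl nonzero_nonunits_carrier by metis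
qed (use b in \<open>auto simp: D_basic_def\<close>)

lemma GD_basic_eq: "GD_basic R a = (\<Union>n\<in>{1::nat..}. D_basic R (a [^] n))"
  by (auto simp: GD_basic_def D_basic_def)

lemma ideal_class_mem_GD_basic:
  assumes b: "b \<in> nonzero_nonunits R"
  shows "ideal_class R b \<in> GD_basic R a \<longleftrightarrow> (\<exists>n\<ge>1::nat. b divides a [^] n)"
  by (auto simp: GD_basic_eq ideal_class_mem_D_basic[OF b])

lemma divides_pow:
  assumes "a \<in> carrier R" "b \<in> carrier R" "b divides a"
  shows "(b [^] (n::nat)) divides (a [^] n)"
  using assms by (auto simp: factor_def nat_pow_distrib)

lemma D_basic_mono:
  assumes "a \<in> carrier R" "c divides a"
  shows "D_basic R c \<subseteq> D_basic R a"
proof -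
  have "b divides a" if "b \<in> nonzero_nonunits R" "b divides c" for b
    using divides_trans[OF that(2) assms(2)] that(1) nonzero_nonunits_carrier by blast
  then show ?thesis by (auto simp: D_basic_def)
qed

lemma GD_basic_mono:
  assumes "a \<in> carrier R" "c \<in> nonzero_nonunits R" "ideal_class R c \<in> GD_basic R a"
  shows "GD_basic R c \<subseteq> GD_basic R a"
proof -
  obtain n :: nat where n: "n \<ge> 1" "c divides a [^] n"
    using assms ideal_class_mem_GD_basic by auto
  have "D_basic R (c [^] m) \<subseteq> D_basic R (a [^] (n * m))" for m :: nat
    using divides_pow[OF _ _ n(2), of m] assms nonzero_nonunits_carrier
    by (intro D_basic_mono) (auto simp: nat_pow_pow)
  then have "D_basic R (c [^] m) \<subseteq> GD_basic R a" if "m \<ge> 1" for m :: nat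
    using that n(1) unfolding GD_basic_eq by (force intro: bexI[of _ "n * m"])
  then show ?thesis by (subst GD_basic_eq) auto
qed

lemma istopology_basisI:
  assumes ex: "\<And>x a. x \<in> F a \<Longrightarrow> \<exists>c\<in>A. x = f c"
    and refl: "\<And>c. c \<in> A \<Longrightarrow> f c \<in> F c"
    and mono: "\<And>a c. a \<in> A \<Longrightarrow> c \<in> A \<Longrightarrow> f c \<in> F a \<Longrightarrow> F c \<subseteq> F a"
  shows "istopology (arbitrary union_of (\<lambda>V. V \<in> F ` A))"
  unfolding istopology_base_eq
proof (intro allI impI, elim conjE imageE)
  fix S T a b assume *: "S = F a" "T = F b" "a \<in> A" "b \<in> A"
  let ?\<U> = "F ` {c \<in> A. f c \<in> F a \<inter> F b}"
  have "\<Union>?\<U> = F a \<inter> F b"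
  proof
    show "\<Union>?\<U> \<subseteq> F a \<inter> F b"
      using mono *(3,4) by blast
    show "F a \<inter> F b \<subseteq> \<Union>?\<U>"
      using ex refl by fastforce
  qed
  then show "(arbitrary union_of (\<lambda>V. V \<in> F ` A)) (S \<inter> T)"
    unfolding * union_of_def arbitrary_def by (intro exI[of _ ?\<U>]) auto
qed

lemma istopology_GD:
  "istopology (arbitrary union_of (\<lambda>V. V \<in> GD_basic R ` nonzero_nonunits R))"
proof (rule istopology_basisI[where f = "ideal_class R" and F = "GD_basic R" and A = "nonzero_nonunits R"])
  show "\<exists>c\<in>nonzero_nonunits R. x = ideal_class R c" if "x \<in> GD_basic R a" for x a
    using that unfolding GD_basic_def by blast
  show "ideal_class R c \<in> GD_basic R c" if "c \<in> nonzero_nonunits R" for c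
    unfolding ideal_class_mem_GD_basic[OF that]
    using that nonzero_nonunits_carrier by (intro exI[of _ "1::nat"]) simp
  show "GD_basic R c \<subseteq> GD_basic R a"
    if "a \<in> nonzero_nonunits R" "c \<in> nonzero_nonunits R" "ideal_class R c \<in> GD_basic R a" for a c
    by (rule GD_basic_mono[OF nonzero_nonunits_carrier[OF that(1)] that(2,3)])
qed

lemma istopology_D:
  "istopology (arbitrary union_of (\<lambda>V. V \<in> D_basic R ` nonzero_nonunits R))"
proof (rule istopology_basisI[where f = "ideal_class R" and F = "D_basic R" and A = "nonzero_nonunits R"])
  show "\<exists>c\<in>nonzero_nonunits R. x = ideal_class R c" if "x \<in> D_basic R a" for x a
    using that unfolding D_basic_def by blast
  show "ideal_class R c \<in> D_basic R c" if "c \<in> nonzero_nonunits R" for c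
    unfolding ideal_class_mem_D_basic[OF that]
    using that nonzero_nonunits_carrier by simp
  show "D_basic R c \<subseteq> D_basic R a"
    if "a \<in> nonzero_nonunits R" "c \<in> nonzero_nonunits R" "ideal_class R c \<in> D_basic R a" for a c
    using D_basic_mono[OF nonzero_nonunits_carrier[OF that(1)]] that(3)
    unfolding ideal_class_mem_D_basic[OF that(2)] by simp
qed

lemma openin_GD:
  "openin (gen_divisor_topology R) = arbitrary union_of (\<lambda>V. V \<in> GD_basic R ` nonzero_nonunits R)"
  unfolding gen_divisor_topology_def by (rule topology_inverse'[OF istopology_GD])

lemma openin_D:
  "openin (divisor_topology R) = arbitrary union_of (\<lambda>V. V \<in> D_basic R ` nonzero_nonunits R)"
  unfolding divisor_topology_def by (rule topology_inverse'[OF istopology_D])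

lemma topspace_basis:
  assumes "openin T = arbitrary union_of (\<lambda>V. V \<in> \<B>)"
  shows "topspace T = \<Union>\<B>"
proof -
  have "openin T V" if "V \<in> \<B>" for V
    using that unfolding assms union_of_def arbitrary_def by (intro exI[of _ "{V}"]) auto
  moreover have "topspace T \<subseteq> \<Union>\<B>"
  proof -
    have "openin T (topspace T)" by simp
    then obtain \<U> where "\<U> \<subseteq> \<B>" "\<Union>\<U> = topspace T"
      unfolding assms union_of_def arbitrary_def by auto
    then show ?thesis by blast
  qed
  ultimately show ?thesis using openin_subset by blast
qed

lemma topspace_GD: "topspace (gen_divisor_topology R) = EC R"
proof -
  have "ideal_class R c \<in> GD_basic R c" if "c \<in> nonzero_nonunits R" for c
    using that nonzero_nonunits_carrier
    unfolding ideal_class_mem_GD_basic[OF that] by (intro exI[of _ "1::nat"]) simp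
  then show ?thesis
    unfolding topspace_basis[OF openin_GD] EC_eq by (auto simp: GD_basic_def)
qed

lemma topspace_D: "topspace (divisor_topology R) = EC R"
proof -
  have "ideal_class R c \<in> D_basic R c" if "c \<in> nonzero_nonunits R" for c
    using that nonzero_nonunits_carrier by (auto simp: ideal_class_mem_D_basic)
  then show ?thesis
    unfolding topspace_basis[OF openin_D] EC_eq by (auto simp: D_basic_def)
qed

end

end

theory Submission
  imports Defs
begin

text \<open>
  Write \<open>b\<close> \<^emph>\<open>divides a power of\<close> \<open>a\<close> for \<open>a \<in> \<surd>(bR)\<close>. The smallest open neighbourhood of the
  class of \<open>a\<close> is its basic set, which consists of the divisors of powers of \<open>a\<close> in \<open>GD(R)\<close> and of
  the divisors of \<open>a\<close> in \<open>D(R)\<close>. Two facts follow.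

  \<^item> Two classes are topologically indistinguishable in \<open>GD(R)\<close> iff each of \<open>a\<close>, \<open>b\<close> divides a power
    of the other, which says \<open>\<surd>(aR) = \<surd>(bR)\<close>. So \<open>T\<^sub>0\<close> is the statement that radicals determine
    principal ideals (lemma \<open>t0_space_iff_radical_determines_ideal\<close>).
  \<^item> The two topologies agree iff, for nonzero nonunits, dividing a power of \<open>a\<close> already implies
    dividing \<open>a\<close> (lemma \<open>topologies_eq_iff\<close>).

  The second condition clearly implies that radicals determine principal ideals. It holds in a von
  Neumann regular ring because there every power of \<open>a\<close> divides \<open>a\<close>, and in the local case because
  there all nonzero nonunits are associated.

  What remains is to get the ring structure from the assumption that radicals determine principal
  ideals, and this is where the work lies. Comparing \<open>a\<close> with \<open>a\<^sup>2\<close> shows that each nonunit either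
  is a multiple of its square or has square zero. If \<open>R\<close> is not von Neumann regular, fix a
  nonzero \<open>a\<close> with \<open>a\<^sup>2 = 0\<close>.
  A nonzero nonunit \<open>b = b\<^sup>2x\<close> would give the nontrivial idempotent \<open>e = bx\<close>, and this is impossible: the
  component \<open>t = a(1 - e)\<close> is nilpotent and orthogonal to \<open>e\<close>, so \<open>(t + e)\<^sup>2 = e\<close>, hence
  \<open>(t + e)R = eR\<close>, hence \<open>t = 0\<close>; by symmetry \<open>ae = 0\<close> as well, so \<open>a = 0\<close>. Therefore all nonunits
  have square zero, any two nonzero ones have the same radical, and \<open>aR\<close> is the set of all nonunits.
\<close>

section \<open>The conditions on the ring\<close>

definition radical_determines_ideal :: "('a, 'b) ring_scheme \<Rightarrow> bool" where
  "radical_determines_ideal R \<longleftrightarrow>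
     (\<forall>a\<in>nonzero_nonunits R. \<forall>b\<in>nonzero_nonunits R.
        radical R (PIdl\<^bsub>R\<^esub> a) = radical R (PIdl\<^bsub>R\<^esub> b) \<longrightarrow> PIdl\<^bsub>R\<^esub> a = PIdl\<^bsub>R\<^esub> b)"

definition divides_power_imp_divides :: "('a, 'b) ring_scheme \<Rightarrow> bool" where
  "divides_power_imp_divides R \<longleftrightarrow>
     (\<forall>a\<in>nonzero_nonunits R. \<forall>b\<in>nonzero_nonunits R.
        (\<exists>n\<ge>1::nat. b divides\<^bsub>R\<^esub> (a [^]\<^bsub>R\<^esub> n)) \<longrightarrow> b divides\<^bsub>R\<^esub> a)"

definition principal_square_zero_local :: "('a, 'b) ring_scheme \<Rightarrow> bool" where
  "principal_square_zero_local R \<longleftrightarrow>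
     local_ring R
     \<and> (\<exists>M. maximalideal M R \<and> M \<noteq> {\<zero>\<^bsub>R\<^esub>} \<and> M = nilradical R
            \<and> (\<exists>a\<in>carrier R. M = PIdl\<^bsub>R\<^esub> a) \<and> M \<cdot>\<^bsub>R\<^esub> M = {\<zero>\<^bsub>R\<^esub>})"

context cring
begin

section \<open>Radicals of principal ideals\<close>

lemma PIdl_subset_iff:
  assumes "a \<in> carrier R" "b \<in> carrier R"
  shows "PIdl a \<subseteq> PIdl b \<longleftrightarrow> b divides a"
proof -
  have "PIdl a \<subseteq> PIdl b \<longleftrightarrow> a \<in> PIdl b"
    using cgenideal_self[OF assms(1)] cgenideal_minimal[OF cgenideal_ideal[OF assms(2)]] by blast
  then show ?thesis using divides_iff_mem_PIdl[OF assms(2)] by simp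
qed

lemma PIdl_eq_iff:
  assumes "a \<in> carrier R" "b \<in> carrier R"
  shows "PIdl a = PIdl b \<longleftrightarrow> a divides b \<and> b divides a"
  unfolding set_eq_subset PIdl_subset_iff[OF assms] PIdl_subset_iff[OF assms(2,1)]
  by (rule conj_commute)

lemma mem_radical_PIdl_iff:
  assumes "a \<in> carrier R" "b \<in> carrier R"
  shows "a \<in> radical R (PIdl b) \<longleftrightarrow> (\<exists>n\<ge>1::nat. b divides (a [^] n))"
  using assms by (simp add: radical_def divides_iff_mem_PIdl)

lemma radical_PIdl_subset_iff:
  assumes a: "a \<in> carrier R" and b: "b \<in> carrier R"
  shows "radical R (PIdl a) \<subseteq> radical R (PIdl b) \<longleftrightarrow> (\<exists>n\<ge>1::nat. b divides (a [^] n))"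
proof
  assume "radical R (PIdl a) \<subseteq> radical R (PIdl b)"
  moreover have "a \<in> radical R (PIdl a)"
    using a by (auto simp: mem_radical_PIdl_iff intro: exI[of _ "1::nat"])
  ultimately show "\<exists>n\<ge>1::nat. b divides (a [^] n)"
    using mem_radical_PIdl_iff[OF a b] by blast
next
  assume "\<exists>n\<ge>1::nat. b divides (a [^] n)"
  then obtain n :: nat where n: "n \<ge> 1" "b divides (a [^] n)" by blast
  show "radical R (PIdl a) \<subseteq> radical R (PIdl b)"
  proof
    fix r assume "r \<in> radical R (PIdl a)"
    moreover from this have r: "r \<in> carrier R" by (simp add: radical_def)
    ultimately obtain m :: nat where m: "m \<ge> 1" "a divides (r [^] m)"
      using mem_radical_PIdl_iff[OF r a] by blast
    have "(a [^] n) divides (r [^] (m * n))"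
      using divides_pow[OF _ a m(2), of n] r by (simp add: nat_pow_pow)
    then have "b divides (r [^] (m * n))"
      using divides_trans[OF n(2)] b by blast
    then show "r \<in> radical R (PIdl b)"
      unfolding mem_radical_PIdl_iff[OF r b] using m(1) n(1) by (intro exI[of _ "m * n"]) simp
  qed
qed

lemma radical_PIdl_eq_iff:
  assumes "a \<in> carrier R" "b \<in> carrier R"
  shows "radical R (PIdl a) = radical R (PIdl b) \<longleftrightarrow>
         (\<exists>n\<ge>1::nat. a divides (b [^] n)) \<and> (\<exists>n\<ge>1::nat. b divides (a [^] n))"
  unfolding set_eq_subset radical_PIdl_subset_iff[OF assms] radical_PIdl_subset_iff[OF assms(2,1)]
  by (rule conj_commute)

lemma radical_determines_idealD:
  assumes "radical_determines_ideal R" "a \<in> nonzero_nonunits R" "b \<in> nonzero_nonunits R"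
    and "n \<ge> 1" "b divides (a [^] (n::nat))" "m \<ge> 1" "a divides (b [^] (m::nat))"
  shows "b divides a"
proof -
  have "a \<in> carrier R" "b \<in> carrier R"
    using assms(2,3) nonzero_nonunits_carrier by blast+
  then have "radical R (PIdl a) = radical R (PIdl b)"
    using assms(4-) by (auto simp: radical_PIdl_eq_iff)
  with \<open>a \<in> carrier R\<close> \<open>b \<in> carrier R\<close> show ?thesis
    using assms(1-3) PIdl_eq_iff[of a b] unfolding radical_determines_ideal_def by simp
qed

lemma divides_power_imp_divides_imp_radical_determines_ideal:
  assumes "divides_power_imp_divides R"
  shows "radical_determines_ideal R"
  unfolding radical_determines_ideal_def
proof (intro ballI impI)
  fix a b assume ab: "a \<in> nonzero_nonunits R" "b \<in> nonzero_nonunits R"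
    and rad: "radical R (PIdl a) = radical R (PIdl b)"
  have car: "a \<in> carrier R" "b \<in> carrier R"
    using ab nonzero_nonunits_carrier by blast+
  then have "\<exists>n\<ge>1::nat. a divides (b [^] n)" "\<exists>n\<ge>1::nat. b divides (a [^] n)"
    using rad by (simp_all add: radical_PIdl_eq_iff)
  then have "a divides b" "b divides a"
    using assms ab unfolding divides_power_imp_divides_def by blast+
  then show "PIdl a = PIdl b" using car by (simp add: PIdl_eq_iff)
qed

section \<open>Minimal neighbourhoods\<close>

text \<open>
  In both topologies each point has a smallest open neighbourhood, because each basic set is a
  principal down-set of a preorder (divisibility, or divisibility of some power). The family \<open>F\<close>
  stands for the basic sets and \<open>f\<close> for the passage from an element to its class.
\<close>

lemma basic_subset_openin:
  assumes "openin T = arbitrary union_of (\<lambda>V. V \<in> F ` A)"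
    and "\<And>a. a \<in> A \<Longrightarrow> f c \<in> F a \<Longrightarrow> F c \<subseteq> F a"
    and "openin T U" "f c \<in> U"
  shows "F c \<subseteq> U"
proof -
  from assms(1,3) obtain \<U> where \<U>: "\<U> \<subseteq> F ` A" "\<Union>\<U> = U"
    unfolding union_of_def arbitrary_def by auto
  then show ?thesis using assms(2,4) by blast
qed

lemma openin_basic:
  assumes "openin T = arbitrary union_of (\<lambda>V. V \<in> F ` A)" "a \<in> A"
  shows "openin T (F a)"
  unfolding assms(1) by (rule union_of_inc) (use assms(2) in \<open>auto simp: arbitrary_def\<close>)

lemma GD_basic_subset_openin:
  assumes "a \<in> nonzero_nonunits R" "openin (gen_divisor_topology R) U" "ideal_class R a \<in> U"
  shows "GD_basic R a \<subseteq> U"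
proof (rule basic_subset_openin[where f = "ideal_class R" and F = "GD_basic R", OF openin_GD _ assms(2,3)])
  show "GD_basic R a \<subseteq> GD_basic R c"
    if "c \<in> nonzero_nonunits R" "ideal_class R a \<in> GD_basic R c" for c
    using GD_basic_mono[OF nonzero_nonunits_carrier[OF that(1)] assms(1) that(2)] .
qed

lemma mem_GD_basic_self:
  assumes "a \<in> nonzero_nonunits R"
  shows "ideal_class R a \<in> GD_basic R a"
  unfolding ideal_class_mem_GD_basic[OF assms]
  using nonzero_nonunits_carrier[OF assms] by (intro exI[of _ "1::nat"]) simp

lemma GD_indistinguishable_iff:
  assumes a: "a \<in> nonzero_nonunits R" and b: "b \<in> nonzero_nonunits R"
  shows "(\<forall>U. openin (gen_divisor_topology R) U \<longrightarrow> (ideal_class R a \<in> U \<longleftrightarrow> ideal_class R b \<in> U))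
         \<longleftrightarrow> radical R (PIdl a) = radical R (PIdl b)"
proof -
  have "(\<forall>U. openin (gen_divisor_topology R) U \<longrightarrow> (ideal_class R a \<in> U \<longleftrightarrow> ideal_class R b \<in> U))
        \<longleftrightarrow> ideal_class R a \<in> GD_basic R b \<and> ideal_class R b \<in> GD_basic R a"
    (is "?L \<longleftrightarrow> ?R")
  proof
    assume ?L
    then show ?R
      using openin_basic[OF openin_GD a] openin_basic[OF openin_GD b]
        mem_GD_basic_self[OF a] mem_GD_basic_self[OF b] by blast
  next
    assume ?R
    then show ?L
      using GD_basic_subset_openin[OF a] GD_basic_subset_openin[OF b] by blast
  qed
  also have "\<dots> \<longleftrightarrow> radical R (PIdl a) = radical R (PIdl b)"
    by (simp add: ideal_class_mem_GD_basic a b radical_PIdl_eq_iff nonzero_nonunits_carrier)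
  finally show ?thesis .
qed

lemma t0_space_iff_radical_determines_ideal:
  "t0_space (gen_divisor_topology R) \<longleftrightarrow> radical_determines_ideal R"
proof -
  have "t0_space (gen_divisor_topology R) \<longleftrightarrow>
        (\<forall>a\<in>nonzero_nonunits R. \<forall>b\<in>nonzero_nonunits R.
          (\<forall>U. openin (gen_divisor_topology R) U \<longrightarrow> (ideal_class R a \<in> U \<longleftrightarrow> ideal_class R b \<in> U))
          \<longrightarrow> ideal_class R a = ideal_class R b)"
    unfolding t0_space_def topspace_GD EC_eq ball_simps by (intro ball_cong refl) blast
  then show ?thesis
    unfolding radical_determines_ideal_def
    by (simp add: GD_indistinguishable_iff ideal_class_eq_iff)
qed

text \<open>
  If the topologies agree, then the \<open>D(R)\<close>-basic set of \<open>a\<close> is open in \<open>GD(R)\<close> and hence contains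
  the smallest \<open>GD(R)\<close>-neighbourhood of the class of \<open>a\<close>. Conversely, the two bases are the same.
\<close>

lemma topologies_eq_iff:
  "gen_divisor_topology R = divisor_topology R \<longleftrightarrow> divides_power_imp_divides R"
proof
  assume eq: "gen_divisor_topology R = divisor_topology R"
  show "divides_power_imp_divides R"
    unfolding divides_power_imp_divides_def
  proof (intro ballI impI)
    fix a b assume a: "a \<in> nonzero_nonunits R" and b: "b \<in> nonzero_nonunits R"
      and dvd: "\<exists>n\<ge>1::nat. b divides (a [^] n)"
    have "openin (gen_divisor_topology R) (D_basic R a)"
      unfolding eq by (rule openin_basic[OF openin_D a])
    moreover have "ideal_class R a \<in> D_basic R a"
      using a nonzero_nonunits_carrier by (simp add: ideal_class_mem_D_basic)
    ultimately have "GD_basic R a \<subseteq> D_basic R a"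
      by (rule GD_basic_subset_openin[OF a])
    then show "b divides a"
      using dvd ideal_class_mem_GD_basic[OF b] ideal_class_mem_D_basic[OF b] by blast
  qed
next
  assume dvd: "divides_power_imp_divides R"
  have "GD_basic R a = D_basic R a" if a: "a \<in> nonzero_nonunits R" for a
  proof -
    have "(\<exists>n\<ge>1::nat. b divides (a [^] n)) \<longleftrightarrow> b divides a" if "b \<in> nonzero_nonunits R" for b
      using dvd a that nonzero_nonunits_carrier unfolding divides_power_imp_divides_def
      by (metis le_refl nat_pow_eone)
    then show ?thesis unfolding GD_basic_def D_basic_def by blast
  qed
  then have "GD_basic R ` nonzero_nonunits R = D_basic R ` nonzero_nonunits R"
    by (rule image_cong[OF refl])
  then show "gen_divisor_topology R = divisor_topology R"
    unfolding gen_divisor_topology_def divisor_topology_def by simp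
qed

section \<open>Von Neumann regular rings\<close>

lemma power_divides_if_square_divides:
  assumes a: "a \<in> carrier R" and x: "x \<in> carrier R" and eq: "a = a [^] (2::nat) \<otimes> x" and "n \<ge> 1"
  shows "(a [^] (n::nat)) divides a"
  using \<open>n \<ge> 1\<close>
proof (induction n rule: dec_induct)
  case base
  show ?case using a by simp
next
  case (step n)
  then obtain y where y: "y \<in> carrier R" "a = a [^] n \<otimes> y" by (auto simp: factor_def)
  have "a [^] Suc n \<otimes> (y \<otimes> x) = (a [^] n \<otimes> y) \<otimes> a \<otimes> x"
    using a x y(1) by (simp add: m_ac)
  also have "\<dots> = a"
    using eq[symmetric] y(2)[symmetric] a by (simp add: numeral_2_eq_2)
  finally show ?case by (rule dividesI'[OF sym]) (use x y(1) in simp)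
qed

lemma von_neumann_regular_imp_divides_power_imp_divides:
  assumes "von_neumann_regular R"
  shows "divides_power_imp_divides R"
  unfolding divides_power_imp_divides_def
proof (intro ballI impI)
  fix a b assume ab: "a \<in> nonzero_nonunits R" "b \<in> nonzero_nonunits R"
    and "\<exists>n\<ge>1::nat. b divides (a [^] n)"
  then obtain n :: nat where n: "n \<ge> 1" "b divides (a [^] n)" by blast
  have car: "a \<in> carrier R" "b \<in> carrier R"
    using ab nonzero_nonunits_carrier by blast+
  then obtain x where "x \<in> carrier R" "a = a [^] (2::nat) \<otimes> x"
    using assms unfolding von_neumann_regular_def by blast
  then have "(a [^] n) divides a"
    using power_divides_if_square_divides car(1) n(1) by blast
  then show "b divides a" using divides_trans[OF n(2)] car by blast
qed

section \<open>Local rings with square-zero principal maximal ideal\<close>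

text \<open>
  If \<open>r\<close> is outside the maximal ideal \<open>M\<close>, then \<open>1 = m + rs\<close> with \<open>m \<in> M\<close>, and \<open>m\<^sup>2 = 0\<close> turns this
  into the explicit inverse \<open>s(1 + m)\<close> of \<open>r\<close>, since \<open>(1 - m)(1 + m) = 1\<close>.
\<close>

lemma Units_if_notin_square_zero_maximalideal:
  assumes "maximalideal M R" and sq: "\<And>m. m \<in> M \<Longrightarrow> m \<otimes> m = \<zero>"
    and r: "r \<in> carrier R" "r \<notin> M"
  shows "r \<in> Units R"
proof -
  interpret M: maximalideal M R by fact
  have PI: "ideal (PIdl r) R" using r(1) by (rule cgenideal_ideal)
  have id: "ideal (M <+>\<^bsub>R\<^esub> PIdl r) R"
    by (rule add_ideals[OF M.is_ideal PI])
  have "m \<in> M <+>\<^bsub>R\<^esub> PIdl r" if "m \<in> M" for m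
  proof -
    have "m = m \<oplus> \<zero>" using M.Icarr[OF that] by simp
    then show ?thesis
      using that additive_subgroup.zero_closed[OF ideal.axioms(1)[OF PI]]
      unfolding set_add_def' by blast
  qed
  moreover have "r \<in> M <+>\<^bsub>R\<^esub> PIdl r"
  proof -
    have "r = \<zero> \<oplus> r" using r(1) by simp
    then show ?thesis
      using M.zero_closed cgenideal_self[OF r(1)] unfolding set_add_def' by blast
  qed
  moreover have "M <+>\<^bsub>R\<^esub> PIdl r \<subseteq> carrier R"
    using ideal.Icarr[OF id] by blast
  ultimately have "M <+>\<^bsub>R\<^esub> PIdl r = carrier R"
    using M.I_maximal[OF id] r(2) by blast
  then have "\<one> \<in> M <+>\<^bsub>R\<^esub> PIdl r" by simp
  then obtain m s where m: "m \<in> M" and s: "s \<in> carrier R" and one: "\<one> = m \<oplus> s \<otimes> r"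
    unfolding set_add_def' cgenideal_def by blast
  have mc: "m \<in> carrier R" using m M.Icarr by blast
  have "(s \<otimes> (\<one> \<oplus> m)) \<otimes> r = (s \<otimes> r) \<otimes> (\<one> \<oplus> m)"
    using s mc r(1) by algebra
  also have "s \<otimes> r = \<one> \<ominus> m"
    using one s mc r(1) by algebra
  also have "(\<one> \<ominus> m) \<otimes> (\<one> \<oplus> m) = \<one> \<ominus> m \<otimes> m"
    using mc by algebra
  also have "\<dots> = \<one>" using sq[OF m] by (simp add: minus_eq)
  finally have "(s \<otimes> (\<one> \<oplus> m)) \<otimes> r = \<one>" .
  then show ?thesis
    using r(1) s mc m_comm[of r "s \<otimes> (\<one> \<oplus> m)"] unfolding Units_def by auto
qed

lemma principal_square_zero_local_imp_divides_power_imp_divides: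
  assumes "principal_square_zero_local R"
  shows "divides_power_imp_divides R"
proof -
  from assms obtain M a where M: "maximalideal M R" and sq: "M \<cdot> M = {\<zero>}"
    and a: "a \<in> carrier R" and Ma: "M = PIdl a"
    unfolding principal_square_zero_local_def by blast
  have prod0: "m \<otimes> m' = \<zero>" if "m \<in> M" "m' \<in> M" for m m'
    using ideal_prod.prod[of m M m' M R] that sq by blast
  have unit: "r \<in> Units R" if "r \<in> carrier R" "r \<notin> M" for r
    using Units_if_notin_square_zero_maximalideal[OF M] prod0 that by blast
  have aM: "a \<in> M" using a Ma cgenideal_self by blast
  have gen: "c divides a \<and> a divides c" if c: "c \<in> nonzero_nonunits R" for c
  proof -
    have cc: "c \<in> carrier R" "c \<noteq> \<zero>" "c \<notin> Units R"
      using c by (auto simp: nonzero_nonunits_def)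
    then have "c \<in> M" using unit by blast
    then have ac: "a divides c" unfolding Ma using divides_iff_mem_PIdl[OF a] by simp
    then obtain r where r: "r \<in> carrier R" "c = a \<otimes> r" by (auto simp: factor_def)
    \<comment> \<open>The cofactor lies outside \<open>M\<close> because otherwise \<open>c \<in> M\<^sup>2 = 0\<close>.\<close>
    have "r \<in> Units R" using unit[OF r(1)] prod0[OF aM] r(2) cc(2) by auto
    then have "a = c \<otimes> inv r" using r a by (simp add: m_assoc)
    then show ?thesis using ac \<open>r \<in> Units R\<close> by (auto intro: dividesI')
  qed
  show ?thesis
    unfolding divides_power_imp_divides_def
  proof (intro ballI impI)
    fix c b assume cb: "c \<in> nonzero_nonunits R" "b \<in> nonzero_nonunits R"
    have "b divides a" "a divides c" using gen cb by simp_all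
    then show "b divides c" using nonzero_nonunits_carrier[OF cb(2)] by (rule divides_trans)
  qed
qed

section \<open>Consequences of radicals determining principal ideals\<close>

text \<open>
  If \<open>a\<^sup>2\<close> is nonzero, then it is again a nonzero nonunit, and it has the same radical as \<open>a\<close>.
\<close>

lemma square_zero_or_square_divides:
  assumes "radical_determines_ideal R" "a \<in> nonzero_nonunits R"
  shows "a \<otimes> a = \<zero> \<or> (a \<otimes> a) divides a"
proof (cases "a \<otimes> a = \<zero>")
  case False
  have a: "a \<in> carrier R" "a \<notin> Units R"
    using assms(2) by (auto simp: nonzero_nonunits_def)
  then have aa: "a \<otimes> a \<in> nonzero_nonunits R"
    using False unit_factor[of a a] by (auto simp: nonzero_nonunits_def)
  have 2: "(a \<otimes> a) divides (a [^] (2::nat))"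
    using a by (simp add: numeral_2_eq_2)
  have 1: "a divides ((a \<otimes> a) [^] (1::nat))"
    using a by (auto simp: factor_def)
  have "(a \<otimes> a) divides a"
    by (rule radical_determines_idealD[OF assms aa one_le_numeral 2 le_refl 1])
  then show ?thesis ..
qed simp

text \<open>
  Adding to \<open>e\<close> a square-zero element orthogonal to it does not change the square, hence not the
  radical, so it cannot change the ideal either. Thus \<open>t \<in> eR\<close>, and orthogonality gives \<open>t = te = 0\<close>.
\<close>

lemma square_zero_orthogonal_to_idempotent:
  assumes rad: "radical_determines_ideal R"
    and e: "e \<in> nonzero_nonunits R" "e \<otimes> e = e"
    and t: "t \<in> carrier R" "t \<otimes> t = \<zero>" "t \<otimes> e = \<zero>"
  shows "t = \<zero>"
proof -
  have ec: "e \<in> carrier R" "e \<noteq> \<zero>" "e \<notin> Units R"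
    using e(1) by (auto simp: nonzero_nonunits_def)
  define c where "c = t \<oplus> e"
  have cc: "c \<in> carrier R" using t ec by (simp add: c_def)
  have "c \<otimes> c = t \<otimes> t \<oplus> t \<otimes> e \<oplus> t \<otimes> e \<oplus> e \<otimes> e"
    unfolding c_def using t(1) ec(1) by algebra
  then have sq: "c \<otimes> c = e" using t e ec by simp
  have cn: "c \<in> nonzero_nonunits R"
    using cc ec sq by (auto simp: nonzero_nonunits_def)
  have 2: "e divides (c [^] (2::nat))"
    using cc ec sq by (simp add: numeral_2_eq_2)
  have 1: "c divides (e [^] (1::nat))"
    using dividesI'[OF sq[symmetric] cc] ec by simp
  have "e divides c"
    by (rule radical_determines_idealD[OF rad cn e(1) one_le_numeral 2 le_refl 1])
  then obtain y where y: "y \<in> carrier R" "c = e \<otimes> y" by (auto simp: factor_def)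
  have "e \<otimes> c = (e \<otimes> e) \<otimes> y" using y ec by (simp add: m_assoc)
  then have "e \<otimes> c = c" using e y by simp
  moreover have "e \<otimes> c = t \<otimes> e \<oplus> e \<otimes> e"
    unfolding c_def using t(1) ec(1) by algebra
  ultimately have "e = t \<oplus> e" using t e ec by (simp add: c_def)
  then have "t \<oplus> e = \<zero> \<oplus> e" using ec(1) by simp
  then show ?thesis using t(1) ec(1) by simp
qed

lemma complement_idempotent:
  assumes e: "e \<in> nonzero_nonunits R" "e \<otimes> e = e"
  shows "\<one> \<ominus> e \<in> nonzero_nonunits R" "(\<one> \<ominus> e) \<otimes> (\<one> \<ominus> e) = \<one> \<ominus> e"
    and "e \<otimes> (\<one> \<ominus> e) = \<zero>"
proof -
  have ec: "e \<in> carrier R" "e \<noteq> \<zero>" "e \<notin> Units R"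
    using e(1) by (auto simp: nonzero_nonunits_def)
  have "e \<otimes> (\<one> \<ominus> e) = e \<ominus> e \<otimes> e" using ec(1) by algebra
  then show orth: "e \<otimes> (\<one> \<ominus> e) = \<zero>" using e ec by (simp add: r_right_minus_eq)
  have "(\<one> \<ominus> e) \<otimes> (\<one> \<ominus> e) = \<one> \<ominus> e \<ominus> e \<otimes> (\<one> \<ominus> e)" using ec(1) by algebra
  then show "(\<one> \<ominus> e) \<otimes> (\<one> \<ominus> e) = \<one> \<ominus> e" unfolding orth using ec by algebra
  have "\<one> \<ominus> e \<noteq> \<zero>" using ec by (metis Units_one_closed one_closed r_right_minus_eq)
  moreover have "\<one> \<ominus> e \<notin> Units R"
  proof
    assume u: "\<one> \<ominus> e \<in> Units R"
    have "e = e \<otimes> (\<one> \<ominus> e) \<otimes> inv (\<one> \<ominus> e)"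
      using u ec by (simp add: m_assoc)
    also have "\<dots> = \<zero>" unfolding orth using u by simp
    finally show False using ec by simp
  qed
  ultimately show "\<one> \<ominus> e \<in> nonzero_nonunits R"
    using ec by (simp add: nonzero_nonunits_def)
qed

text \<open>
  The two components \<open>ae\<close> and \<open>a(1 - e)\<close> of \<open>a\<close> are each orthogonal to one of the idempotents
  \<open>1 - e\<close> and \<open>e\<close>, so both vanish.
\<close>

lemma square_zero_eq_zero_if_nontrivial_idempotent:
  assumes rad: "radical_determines_ideal R"
    and e: "e \<in> nonzero_nonunits R" "e \<otimes> e = e"
    and a: "a \<in> carrier R" "a \<otimes> a = \<zero>"
  shows "a = \<zero>"
proof -
  define f where "f = \<one> \<ominus> e"
  note f = complement_idempotent[OF e, folded f_def]
  have car: "e \<in> carrier R" "f \<in> carrier R"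
    using e f nonzero_nonunits_carrier by blast+
  have sq: "(a \<otimes> g) \<otimes> (a \<otimes> g) = \<zero>" if "g \<in> carrier R" for g
  proof -
    have "(a \<otimes> g) \<otimes> (a \<otimes> g) = (a \<otimes> a) \<otimes> (g \<otimes> g)" using a(1) that by algebra
    then show ?thesis using a that by simp
  qed
  have "a \<otimes> e \<otimes> f = \<zero>" "a \<otimes> f \<otimes> e = \<zero>"
    using f(3) a car by (simp_all add: m_assoc m_comm[of f e])
  then have "a \<otimes> f = \<zero>" "a \<otimes> e = \<zero>"
    using square_zero_orthogonal_to_idempotent[OF rad e, of "a \<otimes> f"]
      square_zero_orthogonal_to_idempotent[OF rad f(1,2), of "a \<otimes> e"] a(1) car sq by simp_all
  moreover have "a = a \<otimes> e \<oplus> a \<otimes> f"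
    unfolding f_def using a(1) car(1) by algebra
  ultimately show ?thesis by simp
qed

text \<open>
  A nonunit \<open>b\<close> whose square is nonzero satisfies \<open>b = b\<^sup>2x\<close>, so \<open>bx\<close> is an idempotent; it is nonzero
  and a nonunit along with \<open>b\<close>, and so cannot coexist with \<open>a\<close>.
\<close>

lemma nonunit_square_zero:
  assumes rad: "radical_determines_ideal R"
    and a: "a \<in> nonzero_nonunits R" "a \<otimes> a = \<zero>"
    and b: "b \<in> nonzero_nonunits R"
  shows "b \<otimes> b = \<zero>"
proof (rule ccontr)
  assume "b \<otimes> b \<noteq> \<zero>"
  then have "(b \<otimes> b) divides b" using square_zero_or_square_divides[OF rad b] by blast
  then obtain x where x: "x \<in> carrier R" "b \<otimes> b \<otimes> x = b" by (metis dividesD)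
  have bc: "b \<in> carrier R" "b \<noteq> \<zero>" "b \<notin> Units R"
    using b by (auto simp: nonzero_nonunits_def)
  define e where "e = b \<otimes> x"
  have "b \<otimes> e = b" using x bc by (simp add: e_def m_assoc)
  then have "e \<noteq> \<zero>" using bc by auto
  moreover have "e \<notin> Units R"
    unfolding e_def using unit_factor[OF _ bc(1) x(1)] bc(3) by blast
  ultimately have en: "e \<in> nonzero_nonunits R"
    using bc x(1) by (simp add: nonzero_nonunits_def e_def)
  have "e \<otimes> e = (b \<otimes> b \<otimes> x) \<otimes> x"
    unfolding e_def using bc(1) x(1) by algebra
  then have "e \<otimes> e = e" using x(2) by (simp add: e_def)
  then have "a = \<zero>"
    by (rule square_zero_eq_zero_if_nontrivial_idempotent
        [OF rad en _ nonzero_nonunits_carrier[OF a(1)] a(2)])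
  then show False using a(1) by (simp add: nonzero_nonunits_def)
qed

text \<open>
  A single nonzero nonunit with square zero forces all nonunits to have square zero. Then any two nonzero
  ones divide a power of each other, namely \<open>0\<close>, and so generate the same ideal. This ideal is the
  set of all nonunits, which is therefore the only maximal ideal.
\<close>

lemma square_zero_nonunit_imp_principal_square_zero_local:
  assumes rad: "radical_determines_ideal R"
    and a: "a \<in> nonzero_nonunits R" "a \<otimes> a = \<zero>"
  shows "principal_square_zero_local R"
proof -
  have ac: "a \<in> carrier R" "a \<noteq> \<zero>" "a \<notin> Units R"
    using a(1) by (auto simp: nonzero_nonunits_def)
  have PI: "ideal (PIdl a) R" using ac(1) by (rule cgenideal_ideal)
  have dvd: "a divides b" if b: "b \<in> nonzero_nonunits R" for b
  proof -
    have bc: "b \<in> carrier R" using b nonzero_nonunits_carrier by blast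
    have "b [^] (2::nat) = \<zero>" "a [^] (2::nat) = \<zero>"
      using nonunit_square_zero[OF rad a b] a ac bc by (simp_all add: numeral_2_eq_2)
    then have "a divides (b [^] (2::nat))" "b divides (a [^] (2::nat))"
      using dividesI'[of \<zero> R _ \<zero>] ac bc by simp_all
    then show ?thesis
      by (rule radical_determines_idealD[OF rad b a(1) one_le_numeral _ one_le_numeral])
  qed
  have nonunits: "PIdl a = carrier R - Units R"
  proof (intro subset_antisym subsetI DiffI)
    fix b assume b: "b \<in> PIdl a"
    then show bc: "b \<in> carrier R" using ideal.Icarr[OF PI] by blast
    show "b \<notin> Units R"
    proof
      assume u: "b \<in> Units R"
      obtain s where "s \<in> carrier R" "b = a \<otimes> s"
        using b ac(1) divides_iff_mem_PIdl[of a b] by (auto simp: factor_def)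
      then show False using u unit_factor[of a s] ac by blast
    qed
  next
    fix b assume "b \<in> carrier R - Units R"
    then have "b = \<zero> \<or> b \<in> nonzero_nonunits R" by (auto simp: nonzero_nonunits_def)
    then show "b \<in> PIdl a"
      using dvd divides_iff_mem_PIdl[OF ac(1)] ideal.axioms(1)[OF PI]
        additive_subgroup.zero_closed by blast
  qed
  have proper: "J \<subseteq> PIdl a" if J: "ideal J R" "J \<noteq> carrier R" for J
  proof
    fix b assume b: "b \<in> J"
    have "b \<notin> Units R"
    proof
      assume "b \<in> Units R"
      then have "\<one> \<in> J" using ideal.I_l_closed[OF J(1) b, of "inv b"] by simp
      then show False using ideal.one_imp_carrier[OF J(1)] J(2) by blast
    qed
    then show "b \<in> PIdl a" unfolding nonunits using ideal.Icarr[OF J(1) b] by blast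
  qed
  have "PIdl a \<noteq> carrier R" using nonunits Units_one_closed one_closed by blast
  then have max: "maximalideal (PIdl a) R"
    using maximalidealI[OF PI] proper by blast
  have "M = PIdl a" if "maximalideal M R" for M
  proof -
    interpret M: maximalideal M R by fact
    have "M \<subseteq> PIdl a" using proper[OF M.is_ideal] M.I_notcarr by blast
    then show ?thesis
      using M.I_maximal[OF PI] \<open>PIdl a \<noteq> carrier R\<close> ideal.Icarr[OF PI] by blast
  qed
  with max have "local_ring R" unfolding local_ring_def by blast
  moreover have "PIdl a \<noteq> {\<zero>}" using cgenideal_self[OF ac(1)] ac(2) by blast
  moreover have "PIdl a = nilradical R"
  proof (intro subset_antisym subsetI)
    fix b assume "b \<in> PIdl a"
    then have bc: "b \<in> carrier R" and "b = \<zero> \<or> b \<in> nonzero_nonunits R"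
      using nonunits by (auto simp: nonzero_nonunits_def)
    then have "b [^] (2::nat) = \<zero>"
      using nonunit_square_zero[OF rad a] by (auto simp: numeral_2_eq_2)
    then show "b \<in> nilradical R"
      using bc unfolding nilradical_def by (auto intro: exI[of _ "2::nat"])
  next
    fix b assume "b \<in> nilradical R"
    then obtain n :: nat where b: "b \<in> carrier R" "b [^] n = \<zero>"
      unfolding nilradical_def by blast
    have "b \<notin> Units R"
    proof
      assume "b \<in> Units R"
      then have "\<zero> \<in> Units R" using Units_pow_closed[of b n] b by simp
      then have "\<zero> \<otimes> inv \<zero> = \<one>" "inv \<zero> \<in> carrier R"
        by (rule Units_r_inv, rule Units_inv_closed)
      then have "\<one> = \<zero>" by (metis l_null)
      then show False using ac one_zeroD by blast
    qed
    then show "b \<in> PIdl a" unfolding nonunits using b by blast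
  qed
  moreover have "(PIdl a) \<cdot> (PIdl a) = {\<zero>}"
  proof -
    have "s = \<zero>" if "s \<in> (PIdl a) \<cdot> (PIdl a)" for s
      using that
    proof (induction s rule: ideal_prod.induct)
      case (prod i j)
      then obtain x y where xy: "x \<in> carrier R" "y \<in> carrier R" "i = x \<otimes> a" "j = y \<otimes> a"
        unfolding cgenideal_def by blast
      have "i \<otimes> j = (a \<otimes> a) \<otimes> (x \<otimes> y)" unfolding xy using xy(1,2) ac(1) by algebra
      then show ?case using a(2) xy by simp
    qed simp
    moreover have "\<zero> \<in> (PIdl a) \<cdot> (PIdl a)"
      using ideal_prod.prod[OF cgenideal_self cgenideal_self, OF ac(1) ac(1)] a(2) by metis
    ultimately show ?thesis by blast
  qed
  ultimately show ?thesis
    unfolding principal_square_zero_local_def using max ac(1) by blast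
qed

lemma radical_determines_ideal_imp_von_neumann_regular_or_local:
  assumes rad: "radical_determines_ideal R"
  shows "von_neumann_regular R \<or> principal_square_zero_local R"
proof (rule disjCI)
  assume notlocal: "\<not> principal_square_zero_local R"
  show "von_neumann_regular R"
    unfolding von_neumann_regular_def
  proof
    fix a assume a: "a \<in> carrier R"
    consider "a = \<zero>" | "a \<in> Units R" | "a \<in> nonzero_nonunits R"
      using a by (auto simp: nonzero_nonunits_def)
    then show "\<exists>x\<in>carrier R. a = a [^] (2::nat) \<otimes> x"
    proof cases
      case 1
      then show ?thesis by (auto simp: numeral_2_eq_2)
    next
      case 2
      then show ?thesis
        using a by (intro bexI[of _ "inv a"]) (simp_all add: numeral_2_eq_2 m_assoc)
    next
      case 3
      then have "(a \<otimes> a) divides a"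
        using square_zero_or_square_divides[OF rad]
          square_zero_nonunit_imp_principal_square_zero_local[OF rad] notlocal by blast
      then have "\<exists>x\<in>carrier R. a = a \<otimes> a \<otimes> x" by (rule dividesD)
      moreover have "a [^] (2::nat) = a \<otimes> a" using a by (simp add: numeral_2_eq_2)
      ultimately show ?thesis by metis
    qed
  qed
qed

section \<open>The equivalence\<close>

lemma radical_determines_ideal_iff_ring_structure:
  "radical_determines_ideal R \<longleftrightarrow> von_neumann_regular R \<or> principal_square_zero_local R"
  using radical_determines_ideal_imp_von_neumann_regular_or_local
    von_neumann_regular_imp_divides_power_imp_divides
    principal_square_zero_local_imp_divides_power_imp_divides
    divides_power_imp_divides_imp_radical_determines_ideal by blast

lemma ring_structure_iff_topologies_eq:
  "von_neumann_regular R \<or> principal_square_zero_local R \<longleftrightarrow>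
   gen_divisor_topology R = divisor_topology R"
  unfolding topologies_eq_iff
  using radical_determines_ideal_imp_von_neumann_regular_or_local
    von_neumann_regular_imp_divides_power_imp_divides
    principal_square_zero_local_imp_divides_power_imp_divides
    divides_power_imp_divides_imp_radical_determines_ideal by blast

end

theorem theorem2p4:
  fixes R :: "('a, 'b) ring_scheme" (structure)
  assumes "cring R" and "\<one> \<noteq> \<zero>"
  shows "(t0_space (gen_divisor_topology R)
          \<longleftrightarrow> (\<forall>a\<in>nonzero_nonunits R. \<forall>b\<in>nonzero_nonunits R.
                 radical R (PIdl a) = radical R (PIdl b) \<longrightarrow> PIdl a = PIdl b))
       \<and> ((\<forall>a\<in>nonzero_nonunits R. \<forall>b\<in>nonzero_nonunits R.
                 radical R (PIdl a) = radical R (PIdl b) \<longrightarrow> PIdl a = PIdl b)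
          \<longleftrightarrow> (von_neumann_regular R
               \<or> (local_ring R
                  \<and> (\<exists>M. maximalideal M R \<and> M \<noteq> {\<zero>} \<and> M = nilradical R
                         \<and> (\<exists>a\<in>carrier R. M = PIdl a) \<and> M \<cdot> M = {\<zero>}))))
       \<and> ((von_neumann_regular R
               \<or> (local_ring R
                  \<and> (\<exists>M. maximalideal M R \<and> M \<noteq> {\<zero>} \<and> M = nilradical R
                         \<and> (\<exists>a\<in>carrier R. M = PIdl a) \<and> M \<cdot> M = {\<zero>})))
          \<longleftrightarrow> gen_divisor_topology R = divisor_topology R)"
proof -
  interpret cring R by fact
  note defs = radical_determines_ideal_def principal_square_zero_local_def
  show ?thesis
    by (intro conjI t0_space_iff_radical_determines_ideal[unfolded defs]
        radical_determines_ideal_iff_ring_structure[unfolded defs]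
        ring_structure_iff_topologies_eq[unfolded defs])
qed

end
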